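(* Let $A$ be a partial combinatory algebra, and suppose $J:\mathcal{P}(A)\to\mathcal{P}(A)$ is (a map representing) a local operator on $\mathsf{RT}(A)$ which is discrete and preserves unions. Then there is a partial function $f$ on $A$ such that $J$ is isomorphic to $J_f$, the least local operator forcing $f$ to be realizable.
   Context: A pca is a set $A$ with a partial binary application $(a,b)\mapsto ab$ (associating to the left) for which there exist $\mathsf{k},\mathsf{s}\in A$ such that for all $a,b,c\in A$: $\mathsf{k}ab=a$; $\mathsf{s}ab$ is defined; and whenever $ac(bc)$ is defined, $\mathsf{s}abc$ is defined and equal to it. $t{\downarrow}$ means "$t$ is defined". Every pca has pairing and unpairing elements $\pi,\pi_0,\pi_1$ with $\pi_0(\pi ab)=a$, $\pi_1(\pi ab)=b$. $\mathrm{Ass}(A)$ has as objects pairs $(X,E)$ with $X$ a set and $E(x)\subseteq A$ nonempty for each $x\in X$; a morphism $(X,E)\to(Y,F)$ is a function $g:X\to Y$ for which some $a\in A$ satisfies $ab{\downarrow}$ and $ab\in F(g(x))$ for all $x\in X$, $b\in E(x)$. The realizability topos $\mathsf{RT}(A)$ is the ex/reg completion of $\mathrm{Ass}(A)$. For $U,V\subseteq A$, $U\Rightarrow V=\{a\in A\mid\forall x\in U\ (ax{\downarrow}\text{ and }ax\in V)\}$. Every local operator (Lawvere–Tierney topology) on $\mathsf{RT}(A)$ is represented by a function $J:\mathcal{P}(A)\to\mathcal{P}(A)$ for which the sets $\bigcap_{U}U\Rightarrow J(U)$, $\bigcap_U JJ(U)\Rightarrow J(U)$ and $\bigcap_{U,V}(U\Rightarrow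 V)\Rightarrow(J(U)\Rightarrow J(V))$ are all nonempty; such a $J$ is itself called a local operator. $J\leq K$ iff $\bigcap_U J(U)\Rightarrow K(U)$ is nonempty; $J$ and $K$ are isomorphic if $J\leq K$ and $K\leq J$. $J$ is discrete if $J(\{a\})\cap J(\{b\})=\emptyset$ whenever $a\neq b$. $J$ preserves unions if $J(\bigcup_i U_i)=\bigcup_i J(U_i)$ for all families of subsets of $A$. For a partial function $f:A\to A$ with domain $B$, let $(B,\{\cdot\})$ be the assembly assigning $\{b\}$ to $b$, and $(B,E)$ the assembly with $E(b)=\{\pi b f(b)\}$. $J_f$, the least local operator forcing $f$ to be realizable, is the least local operator inverting (i.e. whose sheafification makes an isomorphism of) the mono $(B,E)\to(B,\{\cdot\})$ given by the identity on $B$. Equivalently, it is the least local operator $J$ with $M\leq J$, where $M(U)=\{\pi be\mid b\in B,\ ef(b){\downarrow},\ ef(b)\in U\}$. *)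

theory Defs
  imports Main
begin

text \<open>The underlying set of a pca is a type; application is a partial binary operation.\<close>

type_synonym 'a papp = "'a \<Rightarrow> 'a \<Rightarrow> 'a option"

text \<open>Note that the definedness of \<open>s a b c\<close> is only required when \<open>a c (b c)\<close> is defined; the
  converse is not required.\<close>

definition pca :: "'a papp \<Rightarrow> bool" where
  "pca app \<longleftrightarrow> (\<exists>k s.
     (\<forall>a b. \<exists>ka. app k a = Some ka \<and> app ka b = Some a) \<and>
     (\<forall>a b. \<exists>sa sab. app s a = Some sa \<and> app sa b = Some sab \<and>
        (\<forall>c ac bc d. app a c = Some ac \<and> app b c = Some bc \<and> app ac bc = Some d
            \<longrightarrow> app sab c = Some d)))"

definition app2 :: "'a papp \<Rightarrow> 'a \<Rightarrow> 'a \<Rightarrow> 'a \<Rightarrow> 'a option" where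
  "app2 app a b c = (case app a b of None \<Rightarrow> None | Some ab \<Rightarrow> app ab c)"

definition pairing :: "'a papp \<Rightarrow> 'a \<Rightarrow> 'a \<Rightarrow> 'a \<Rightarrow> bool" where
  "pairing app p p0 p1 \<longleftrightarrow>
     (\<forall>a b. \<exists>c. app2 app p a b = Some c \<and> app p0 c = Some a \<and> app p1 c = Some b)"


subsection \<open>Local operators\<close>

definition imp :: "'a papp \<Rightarrow> 'a set \<Rightarrow> 'a set \<Rightarrow> 'a set" where
  "imp app U V = {a. \<forall>x\<in>U. \<exists>y\<in>V. app a x = Some y}"

definition local_operator :: "'a papp \<Rightarrow> ('a set \<Rightarrow> 'a set) \<Rightarrow> bool" where
  "local_operator app J \<longleftrightarrow>
     (\<Inter>U. imp app U (J U)) \<noteq> {} \<and>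
     (\<Inter>U. imp app (J (J U)) (J U)) \<noteq> {} \<and>
     (\<Inter>U. \<Inter>V. imp app (imp app U V) (imp app (J U) (J V))) \<noteq> {}"

definition op_le :: "'a papp \<Rightarrow> ('a set \<Rightarrow> 'a set) \<Rightarrow> ('a set \<Rightarrow> 'a set) \<Rightarrow> bool" where
  "op_le app J K \<longleftrightarrow> (\<Inter>U. imp app (J U) (K U)) \<noteq> {}"

definition op_iso :: "'a papp \<Rightarrow> ('a set \<Rightarrow> 'a set) \<Rightarrow> ('a set \<Rightarrow> 'a set) \<Rightarrow> bool" where
  "op_iso app J K \<longleftrightarrow> op_le app J K \<and> op_le app K J"

definition discrete_op :: "('a set \<Rightarrow> 'a set) \<Rightarrow> bool" where
  "discrete_op J \<longleftrightarrow> (\<forall>a b. a \<noteq> b \<longrightarrow> J {a} \<inter> J {b} = {})"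

definition preserves_unions :: "('a set \<Rightarrow> 'a set) \<Rightarrow> bool" where
  "preserves_unions J \<longleftrightarrow> (\<forall>\<U>. J (\<Union>\<U>) = (\<Union>U\<in>\<U>. J U))"


subsection \<open>Sheafification\<close>

text \<open>\<open>RT(A)\<close> is presented as the category of sets \<open>X\<close> with a \<open>\<P>(A)\<close>-valued partial equivalence
  relation and, as morphisms, functional relations up to logical equivalence.  The topos of sheaves
  for \<open>J\<close> is obtained in the same way from the tripos whose predicates are again the maps
  \<open>X \<rightarrow> \<P>(A)\<close>, with entailment \<open>\<phi> \<turnstile>\<^sub>J \<psi>\<close> iff \<open>\<Inter>x. \<phi> x \<Rightarrow> J (\<psi> x)\<close> is nonempty; in this presentation
  sheafification sends the object \<open>(X, \<approx>)\<close> to itself and the class of a functional relation to its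
  class.  Conjunction and existential quantification (along a projection) are computed as for
  \<open>\<P>(A)\<close>, by pairing and by union.\<close>

definition entails ::
  "'a papp \<Rightarrow> ('a set \<Rightarrow> 'a set) \<Rightarrow> 'i set \<Rightarrow> ('i \<Rightarrow> 'a set) \<Rightarrow> ('i \<Rightarrow> 'a set) \<Rightarrow> bool" where
  "entails app J I \<phi> \<psi> \<longleftrightarrow> (\<Inter>i\<in>I. imp app (\<phi> i) (J (\<psi> i))) \<noteq> {}"

definition conj_pred :: "'a papp \<Rightarrow> 'a \<Rightarrow> 'a set \<Rightarrow> 'a set \<Rightarrow> 'a set" where
  "conj_pred app p U V = {c. \<exists>u\<in>U. \<exists>v\<in>V. app2 app p u v = Some c}"

definition functional_rel ::
  "'a papp \<Rightarrow> 'a \<Rightarrow> ('a set \<Rightarrow> 'a set) \<Rightarrow> 'x set \<Rightarrow> ('x \<Rightarrow> 'x \<Rightarrow> 'a set) \<Rightarrow>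
   'y set \<Rightarrow> ('y \<Rightarrow> 'y \<Rightarrow> 'a set) \<Rightarrow> ('x \<Rightarrow> 'y \<Rightarrow> 'a set) \<Rightarrow> bool" where
  "functional_rel app p J X eqX Y eqY R \<longleftrightarrow>
     entails app J (X \<times> Y) (\<lambda>(x, y). R x y) (\<lambda>(x, y). conj_pred app p (eqX x x) (eqY y y)) \<and>
     entails app J ((X \<times> X) \<times> (Y \<times> Y))
       (\<lambda>((x, x'), (y, y')). conj_pred app p (R x y) (conj_pred app p (eqX x x') (eqY y y')))
       (\<lambda>((x, x'), (y, y')). R x' y') \<and>
     entails app J (X \<times> (Y \<times> Y))
       (\<lambda>(x, (y, y')). conj_pred app p (R x y) (R x y')) (\<lambda>(x, (y, y')). eqY y y') \<and>
     entails app J X (\<lambda>x. eqX x x) (\<lambda>x. \<Union>y\<in>Y. R x y)"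

definition rel_compose ::
  "'a papp \<Rightarrow> 'a \<Rightarrow> 'y set \<Rightarrow> ('x \<Rightarrow> 'y \<Rightarrow> 'a set) \<Rightarrow> ('y \<Rightarrow> 'z \<Rightarrow> 'a set) \<Rightarrow> 'x \<Rightarrow> 'z \<Rightarrow> 'a set" where
  "rel_compose app p Y R S x z = (\<Union>y\<in>Y. conj_pred app p (R x y) (S y z))"

definition rel_equiv ::
  "'a papp \<Rightarrow> ('a set \<Rightarrow> 'a set) \<Rightarrow> 'x set \<Rightarrow> 'y set \<Rightarrow>
   ('x \<Rightarrow> 'y \<Rightarrow> 'a set) \<Rightarrow> ('x \<Rightarrow> 'y \<Rightarrow> 'a set) \<Rightarrow> bool" where
  "rel_equiv app J X Y R S \<longleftrightarrow>
     entails app J (X \<times> Y) (\<lambda>(x, y). R x y) (\<lambda>(x, y). S x y) \<and>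
     entails app J (X \<times> Y) (\<lambda>(x, y). S x y) (\<lambda>(x, y). R x y)"

text \<open>An assembly \<open>(X, E)\<close> is viewed in \<open>RT(A)\<close> as \<open>X\<close> with the equality predicate \<open>asm_eq E\<close>; a
  morphism \<open>g\<close> of assemblies is viewed as the functional relation \<open>asm_graph\<close>.\<close>

definition asm_eq :: "('x \<Rightarrow> 'a set) \<Rightarrow> 'x \<Rightarrow> 'x \<Rightarrow> 'a set" where
  "asm_eq E x x' = (if x = x' then E x else {})"

definition asm_graph ::
  "'a papp \<Rightarrow> 'a \<Rightarrow> ('x \<Rightarrow> 'a set) \<Rightarrow> ('y \<Rightarrow> 'a set) \<Rightarrow> ('x \<Rightarrow> 'y) \<Rightarrow> 'x \<Rightarrow> 'y \<Rightarrow> 'a set" where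
  "asm_graph app p E F g x y = conj_pred app p (asm_eq E x x) (asm_eq F (g x) y)"

text \<open>The sheafification for \<open>J\<close> of the morphism \<open>g : (X, E) \<rightarrow> (Y, F)\<close> has a two-sided inverse; the
  identity morphism on an object is its equality predicate.\<close>

definition inverts ::
  "'a papp \<Rightarrow> 'a \<Rightarrow> ('a set \<Rightarrow> 'a set) \<Rightarrow> 'x set \<Rightarrow> ('x \<Rightarrow> 'a set) \<Rightarrow>
   'y set \<Rightarrow> ('y \<Rightarrow> 'a set) \<Rightarrow> ('x \<Rightarrow> 'y) \<Rightarrow> bool" where
  "inverts app p J X E Y F g \<longleftrightarrow>
     (\<exists>S. functional_rel app p J Y (asm_eq F) X (asm_eq E) S \<and>
          rel_equiv app J X X (rel_compose app p Y (asm_graph app p E F g) S) (asm_eq E) \<and>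
          rel_equiv app J Y Y (rel_compose app p X S (asm_graph app p E F g)) (asm_eq F))"


subsection \<open>Forcing a partial function to be realizable\<close>

definition graph_assembly :: "'a papp \<Rightarrow> 'a \<Rightarrow> ('a \<rightharpoonup> 'a) \<Rightarrow> 'a \<Rightarrow> 'a set" where
  "graph_assembly app p f b = {c. \<exists>y. f b = Some y \<and> app2 app p b y = Some c}"

definition forces_realizable :: "'a papp \<Rightarrow> 'a \<Rightarrow> ('a set \<Rightarrow> 'a set) \<Rightarrow> ('a \<rightharpoonup> 'a) \<Rightarrow> bool" where
  "forces_realizable app p J f \<longleftrightarrow>
     inverts app p J (dom f) (graph_assembly app p f) (dom f) (\<lambda>b. {b}) (\<lambda>b. b)"

text \<open>\<open>K\<close> is (a map representing) \<open>J\<^sub>f\<close>; this determines \<open>K\<close> up to isomorphism.\<close>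

definition least_op_forcing :: "'a papp \<Rightarrow> 'a \<Rightarrow> ('a \<rightharpoonup> 'a) \<Rightarrow> ('a set \<Rightarrow> 'a set) \<Rightarrow> bool" where
  "least_op_forcing app p f K \<longleftrightarrow>
     local_operator app K \<and> forces_realizable app p K f \<and>
     (\<forall>L. local_operator app L \<and> forces_realizable app p L f \<longrightarrow> op_le app K L)"

end

theory Submission
  imports Defs
begin

text \<open>Since \<open>J\<close> preserves unions, it is determined by the sets \<open>J {a}\<close>, and since \<open>J\<close> is discrete
  these are the fibres of a partial function \<open>f\<close>; so \<open>J U\<close> is the preimage of \<open>U\<close> under \<open>f\<close>, and
  \<open>J\<close> itself turns out to be \<open>J\<^sub>f\<close>.  On the one hand \<open>b \<in> J {f b}\<close>, whence monotonicity of \<open>J\<close>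
  applied to \<open>\<pi> b\<close> computes from \<open>b\<close> an element of \<open>J {\<pi> b (f b)}\<close>, which is what an inverse of the
  mono \<open>(B, E) \<rightarrow> (B, {\<cdot>})\<close> requires.  On the other hand, for any local operator \<open>L\<close> inverting this
  mono, the identity \<open>g \<circ> g\<^sup>-\<^sup>1 = 1\<close> computes from \<open>b\<close> an element of \<open>L {f b}\<close>, and \<open>L {f b}\<close> maps
  to \<open>L U\<close> whenever \<open>b \<in> J U\<close>.\<close>

section \<open>Functions realized on a given domain\<close>

definition computable :: "'a papp \<Rightarrow> 'a set \<Rightarrow> ('a \<Rightarrow> 'a) \<Rightarrow> bool" where
  "computable app D F \<longleftrightarrow> (\<exists>r. \<forall>x\<in>D. app r x = Some (F x))"

lemma computableI: "(\<And>x. x \<in> D \<Longrightarrow> app r x = Some (F x)) \<Longrightarrow> computable app D F"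
  by (auto simp: computable_def)

text \<open>The realizer is \<open>s rF rG\<close>: by the law of \<open>s\<close> it sends
  \<open>x\<close> to \<open>F x\<close> applied to \<open>G x\<close> whenever that application is
  defined. Together with constants and identity this replaces explicit combinator terms in
  everything below.\<close>

lemma computable_app:
  assumes "pca app" "computable app D F" "computable app D G"
    and "\<And>x. x \<in> D \<Longrightarrow> app (F x) (G x) = Some (H x)"
  shows "computable app D H"
proof -
  obtain s where s: "\<And>a b. \<exists>sa sab. app s a = Some sa \<and> app sa b = Some sab \<and>
      (\<forall>c ac bc d. app a c = Some ac \<and> app b c = Some bc \<and> app ac bc = Some d
        \<longrightarrow> app sab c = Some d)"
    using assms(1) unfolding pca_def by blast
  obtain rF rG where "\<forall>x\<in>D. app rF x = Some (F x)" "\<forall>x\<in>D. app rG x = Some (G x)"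
    using assms(2,3) unfolding computable_def by blast
  then show ?thesis
    using s[of rF rG] assms(4) unfolding computable_def by blast
qed

lemma pca_constant_function:
  assumes "pca app"
  obtains k where "\<And>a. \<exists>ka. app k a = Some ka \<and> (\<forall>b. app ka b = Some a)"
proof -
  obtain k where "\<And>a b. \<exists>ka. app k a = Some ka \<and> app ka b = Some a"
    using assms unfolding pca_def by blast
  then have "\<exists>ka. app k a = Some ka \<and> (\<forall>b. app ka b = Some a)" for a
    by (metis option.inject)
  then show thesis using that by blast
qed

lemma computable_const:
  assumes "pca app"
  shows "computable app D (\<lambda>_. a)"
proof -
  obtain k where "\<And>a. \<exists>ka. app k a = Some ka \<and> (\<forall>b. app ka b = Some a)"
    using pca_constant_function[OF assms] by blast
  from this[of a] show ?thesis
    unfolding computable_def by blast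
qed

lemma computable_id:
  assumes "pca app"
  shows "computable app D (\<lambda>x. x)"
proof -
  obtain k where k: "\<And>a. \<exists>ka. app k a = Some ka \<and> (\<forall>b. app ka b = Some a)"
    using pca_constant_function[OF assms] by blast
  have kx: "computable app D (\<lambda>x. the (app k x))"
    by (rule computableI[where r = k]) (metis k option.sel)
  \<comment> \<open>Applying \<open>k x\<close> to anything returns \<open>x\<close>, in particular
    to \<open>k x\<close> itself: this is the identity as \<open>s k k\<close>.\<close>
  have "app (the (app k x)) (the (app k x)) = Some x" for x
    using k[of x] by force
  then show ?thesis
    by (rule computable_app[OF assms kx kx])
qed

lemma computable_app_const:
  assumes "pca app" "computable app D F" "\<And>x. x \<in> D \<Longrightarrow> app r (F x) = Some (H x)"
  shows "computable app D H"
  by (rule computable_app[OF assms(1) computable_const[OF assms(1)] assms(2,3)])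

section \<open>Entailment relative to a local operator\<close>

lemma local_operator_unit:
  assumes "local_operator app J"
  obtains u where "\<And>U x. x \<in> U \<Longrightarrow> \<exists>y\<in>J U. app u x = Some y"
proof -
  have "(\<Inter>U. imp app U (J U)) \<noteq> {}"
    using assms unfolding local_operator_def by (elim conjE)
  then obtain u where "u \<in> (\<Inter>U. imp app U (J U))"
    unfolding ex_in_conv[symmetric] ..
  then show thesis using that unfolding imp_def by blast
qed

lemma local_operator_mono:
  assumes "local_operator app J"
  obtains m where "\<And>U V n. n \<in> imp app U V \<Longrightarrow> \<exists>q\<in>imp app (J U) (J V). app m n = Some q"
proof -
  obtain m where "m \<in> (\<Inter>U. \<Inter>V. imp app (imp app U V) (imp app (J U) (J V)))"
    using assms unfolding local_operator_def by blast
  then have "\<And>U V n. n \<in> imp app U V \<Longrightarrow> \<exists>q\<in>imp app (J U) (J V). app m n = Some q"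
    unfolding imp_def[of app "imp app _ _"] by blast
  then show thesis using that by blast
qed

lemma entails_iff:
  "entails app J I \<phi> \<psi> \<longleftrightarrow> (\<exists>r. \<forall>i\<in>I. \<forall>x\<in>\<phi> i. \<exists>y\<in>J (\<psi> i). app r x = Some y)"
  unfolding entails_def imp_def by blast

lemma entails_by_computable:
  assumes "computable app (\<Union>i\<in>I. \<phi> i) H" "\<And>i x. i \<in> I \<Longrightarrow> x \<in> \<phi> i \<Longrightarrow> H x \<in> J (\<psi> i)"
  shows "entails app J I \<phi> \<psi>"
proof -
  obtain r where "\<And>x. x \<in> (\<Union>i\<in>I. \<phi> i) \<Longrightarrow> app r x = Some (H x)"
    using assms(1) unfolding computable_def by blast
  then show ?thesis using assms(2) unfolding entails_iff by blast
qed

lemma entails_unit: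
  assumes "pca app" "local_operator app J"
    and "computable app (\<Union>i\<in>I. \<phi> i) F" "\<And>i x. i \<in> I \<Longrightarrow> x \<in> \<phi> i \<Longrightarrow> F x \<in> \<psi> i"
  shows "entails app J I \<phi> \<psi>"
proof -
  obtain u where u: "\<And>U x. x \<in> U \<Longrightarrow> \<exists>y\<in>J U. app u x = Some y"
    using local_operator_unit[OF assms(2)] by blast
  have "computable app (\<Union>i\<in>I. \<phi> i) (\<lambda>x. the (app u (F x)))"
    by (rule computable_app_const[OF assms(1,3), where r = u])
       (metis u UNIV_I option.sel)
  moreover have "the (app u (F x)) \<in> J (\<psi> i)" if "i \<in> I" "x \<in> \<phi> i" for i x
    using u[OF assms(4)[OF that]] by auto
  ultimately show ?thesis by (rule entails_by_computable)
qed

text \<open>Monotonicity of \<open>J\<close> turns a realizer \<open>n\<close> of \<open>F\<close>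
  into one acting between values of \<open>J\<close>; the result is realized by
  \<open>x \<mapsto> (m n) (t x)\<close>. The index \<open>i\<close> may depend on \<open>x\<close>
  as well as on \<open>k\<close>, since it does not enter the realizer.\<close>

lemma entails_map:
  assumes "pca app" "local_operator app J" "entails app J I \<phi> \<psi>"
    and "computable app (\<Union>i\<in>I. \<psi> i) F"
    and "\<And>k x. k \<in> K \<Longrightarrow> x \<in> \<phi>' k \<Longrightarrow> \<exists>i\<in>I. x \<in> \<phi> i \<and> F ` \<psi> i \<subseteq> \<chi> k"
  shows "entails app J K \<phi>' \<chi>"
proof -
  obtain m where m: "\<And>U V n. n \<in> imp app U V \<Longrightarrow> \<exists>q\<in>imp app (J U) (J V). app m n = Some q"
    using local_operator_mono[OF assms(2)] by blast
  obtain t where t: "\<And>i x. i \<in> I \<Longrightarrow> x \<in> \<phi> i \<Longrightarrow> \<exists>y\<in>J (\<psi> i). app t x = Some y"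
    using assms(3) unfolding entails_iff by blast
  obtain n where n: "\<And>i x. i \<in> I \<Longrightarrow> x \<in> \<psi> i \<Longrightarrow> app n x = Some (F x)"
    using assms(4) unfolding computable_def by blast
  \<comment> \<open>Since \<open>m\<close> lies in the intersection over all \<open>U\<close> and
    \<open>V\<close>, one \<open>q\<close> serves every pair \<open>i\<close>,
    \<open>k\<close>.\<close>
  define q where "q = the (app m n)"
  have ex: "\<exists>y z. app t x = Some y \<and> app q y = Some z \<and> z \<in> J (\<chi> k)"
    if "k \<in> K" "x \<in> \<phi>' k" for k x
  proof -
    obtain i where i: "i \<in> I" "x \<in> \<phi> i" "F ` \<psi> i \<subseteq> \<chi> k"
      using assms(5)[OF \<open>k \<in> K\<close> \<open>x \<in> \<phi>' k\<close>] by blast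
    have "n \<in> imp app (\<psi> i) (\<chi> k)"
      using n[OF i(1)] i(3) unfolding imp_def by blast
    then have "q \<in> imp app (J (\<psi> i)) (J (\<chi> k))"
      using m unfolding q_def by (metis option.sel)
    then show ?thesis
      using t[OF i(1,2)] unfolding imp_def by blast
  qed
  let ?D = "\<Union>k\<in>K. \<phi>' k"
  have "computable app ?D (\<lambda>x. the (app t x))"
    by (rule computableI[where r = t]) (use ex in fastforce)
  then have "computable app ?D (\<lambda>x. the (app q (the (app t x))))"
    by (rule computable_app_const[OF assms(1), where r = q]) (use ex in fastforce)
  then show ?thesis
    by (rule entails_by_computable) (use ex in fastforce)
qed

text \<open>Taking the subsets \<open>U\<close> themselves as indices makes comparison of operators
  accessible to the entailment rules.\<close>

lemma op_le_iff_entails: "op_le app J K \<longleftrightarrow> entails app K UNIV J (\<lambda>U. U)"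
  unfolding op_le_def entails_def by simp

lemma op_iso_refl:
  assumes "pca app"
  shows "op_iso app J J"
  unfolding op_iso_def op_le_iff_entails
  by (intro conjI entails_by_computable[OF computable_id[OF assms]])


section \<open>Pairing, and inverting the mono that belongs to a partial function\<close>

locale pca_pairing =
  fixes app :: "'a papp" and p p0 p1 :: 'a
  assumes pca: "pca app" and pairing: "pairing app p p0 p1"
begin

definition pr :: "'a \<Rightarrow> 'a \<Rightarrow> 'a" where "pr a b = the (app2 app p a b)"
definition left :: "'a \<Rightarrow> 'a" where "left c = the (app p0 c)"
definition right :: "'a \<Rightarrow> 'a" where "right c = the (app p1 c)"

lemma app2_pr [simp]: "app2 app p a b = Some (pr a b)"
  using pairing unfolding pairing_def pr_def by (metis option.sel)

lemma app_p0_pr: "app p0 (pr a b) = Some a" and app_p1_pr: "app p1 (pr a b) = Some b"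
  using pairing app2_pr unfolding pairing_def by (metis option.sel)+

lemma left_pr [simp]: "left (pr a b) = a" and right_pr [simp]: "right (pr a b) = b"
  by (simp_all add: left_def right_def app_p0_pr app_p1_pr)

lemma app_p: "app p a = Some (the (app p a))"
  and app_p_app: "app (the (app p a)) b = Some (pr a b)"
  using app2_pr[of a b] unfolding app2_def by (auto split: option.splits)

lemma conj_pred_eq: "conj_pred app p U V = {pr u v | u v. u \<in> U \<and> v \<in> V}"
  unfolding conj_pred_def by auto

lemma graph_assembly_eq: "graph_assembly app p f b = {pr b y | y. f b = Some y}"
  unfolding graph_assembly_def by auto

lemma computable_pr:
  assumes "computable app D F" "computable app D G"
  shows "computable app D (\<lambda>x. pr (F x) (G x))"
proof -
  have "computable app D (\<lambda>x. the (app p (F x)))"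
    by (rule computable_app_const[OF pca assms(1) app_p])
  then show ?thesis
    by (rule computable_app[OF pca _ assms(2) app_p_app])
qed

text \<open>Off the pairs \<open>app p0\<close> may be undefined, hence the condition on the values
  of \<open>F\<close>.\<close>

lemma computable_left:
  assumes "computable app D F" "\<And>x. x \<in> D \<Longrightarrow> \<exists>a b. F x = pr a b"
  shows "computable app D (\<lambda>x. left (F x))"
  by (rule computable_app_const[OF pca assms(1), where r = p0])
     (use assms(2) in \<open>fastforce simp: app_p0_pr\<close>)

lemma computable_right:
  assumes "computable app D F" "\<And>x. x \<in> D \<Longrightarrow> \<exists>a b. F x = pr a b"
  shows "computable app D (\<lambda>x. right (F x))"
  by (rule computable_app_const[OF pca assms(1), where r = p1])
     (use assms(2) in \<open>fastforce simp: app_p1_pr\<close>)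

lemmas computable_intros =
  computable_pr computable_left computable_right computable_id[OF pca]

lemma entails_value_of_forces_realizable:
  assumes "local_operator app L" "forces_realizable app p L f"
  shows "entails app L (dom f) (\<lambda>b. {b}) (\<lambda>b. {the (f b)})"
proof -
  let ?E = "graph_assembly app p f" and ?F = "\<lambda>b. {b}" and ?B = "dom f"
  obtain S where "rel_equiv app L ?B ?B
      (rel_compose app p ?B S (asm_graph app p ?E ?F (\<lambda>b. b))) (asm_eq ?F)"
    using assms(2) unfolding forces_realizable_def inverts_def by blast
  then have S: "entails app L (?B \<times> ?B) (\<lambda>(x, y). asm_eq ?F x y)
      (\<lambda>(x, y). rel_compose app p ?B S (asm_graph app p ?E ?F (\<lambda>b. b)) x y)"
    unfolding rel_equiv_def by blast
  \<comment> \<open>The graph of the mono records an element of the source assembly at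
    \<open>y\<close>, which is a pair of \<open>y\<close> and \<open>f y\<close>; this is where the
    value of \<open>f\<close> can be read off.\<close>
  have mem: "\<exists>s v. c = pr s (pr (pr y v) y) \<and> f y = Some v"
    if "c \<in> rel_compose app p ?B S (asm_graph app p ?E ?F (\<lambda>b. b)) x y" for c x y
    using that
    by (auto simp: rel_compose_def asm_graph_def asm_eq_def conj_pred_eq graph_assembly_eq
             split: if_splits)
  show ?thesis
  proof (rule entails_map[OF pca assms(1) S, where F = "\<lambda>c. right (left (right c))"])
    show "computable app (\<Union>i\<in>?B \<times> ?B. case i of (x, y) \<Rightarrow>
        rel_compose app p ?B S (asm_graph app p ?E ?F (\<lambda>b. b)) x y)
        (\<lambda>c. right (left (right c)))"
      by (intro computable_intros) (fastforce dest!: mem)+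
  next
    fix b x assume "b \<in> ?B" "x \<in> {b}"
    then show "\<exists>i\<in>?B \<times> ?B. x \<in> (case i of (x, y) \<Rightarrow> asm_eq ?F x y) \<and>
        (\<lambda>c. right (left (right c))) ` (case i of (x, y) \<Rightarrow>
          rel_compose app p ?B S (asm_graph app p ?E ?F (\<lambda>b. b)) x y) \<subseteq> {the (f b)}"
      by (intro bexI[of _ "(b, b)"]) (auto simp: asm_eq_def dest!: mem)
  qed
qed

text \<open>The inverse is the equality predicate of the source assembly, read as a relation from
  the target. Most conditions only rearrange pairs and follow from the unit of \<open>J\<close>;
  totality and the second half of the last identity must produce \<open>pr b (f b)\<close> from
  \<open>b\<close> alone, and these two use \<open>graph\<close>.\<close>

lemma forces_realizable_if_entails_graph:
  assumes J: "local_operator app J"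
    and graph: "entails app J (dom f) (\<lambda>b. {b}) (graph_assembly app p f)"
  shows "forces_realizable app p J f"
proof -
  let ?E = "graph_assembly app p f" and ?F = "\<lambda>b. {b}" and ?B = "dom f"
  let ?S = "asm_eq ?E" and ?G = "asm_graph app p ?E ?F (\<lambda>b. b)"
  note unit = entails_unit[OF pca J]
  note defs = asm_eq_def asm_graph_def rel_compose_def conj_pred_eq graph_assembly_eq
  have "functional_rel app p J ?B (asm_eq ?F) ?B (asm_eq ?E) ?S"
    unfolding functional_rel_def
  proof (intro conjI)
    show "entails app J (?B \<times> ?B) (\<lambda>(x, y). ?S x y)
        (\<lambda>(x, y). conj_pred app p (asm_eq ?F x x) (asm_eq ?E y y))"
      by (rule unit[where F = "\<lambda>c. pr (left c) c"], intro computable_intros)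
         (auto simp: defs split: if_splits)
    show "entails app J ((?B \<times> ?B) \<times> (?B \<times> ?B))
        (\<lambda>((x, x'), (y, y')). conj_pred app p (?S x y)
          (conj_pred app p (asm_eq ?F x x') (asm_eq ?E y y')))
        (\<lambda>((x, x'), (y, y')). ?S x' y')"
      by (rule unit[where F = left], intro computable_intros)
         (fastforce simp: defs split: if_splits)+
    show "entails app J (?B \<times> (?B \<times> ?B))
        (\<lambda>(x, (y, y')). conj_pred app p (?S x y) (?S x y')) (\<lambda>(x, (y, y')). asm_eq ?E y y')"
      by (rule unit[where F = left], intro computable_intros)
         (fastforce simp: defs split: if_splits)+
    show "entails app J ?B (\<lambda>x. asm_eq ?F x x) (\<lambda>x. \<Union>y\<in>?B. ?S x y)"
      by (rule entails_map[OF pca J graph, where F = "\<lambda>x. x"], intro computable_intros)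
         (auto simp: defs)
  qed
  moreover have "rel_equiv app J ?B ?B (rel_compose app p ?B ?G ?S) (asm_eq ?E)"
    unfolding rel_equiv_def
  proof (intro conjI)
    show "entails app J (?B \<times> ?B) (\<lambda>(x, y). rel_compose app p ?B ?G ?S x y)
        (\<lambda>(x, y). asm_eq ?E x y)"
      by (rule unit[where F = right], intro computable_intros)
         (fastforce simp: defs split: if_splits)+
    show "entails app J (?B \<times> ?B) (\<lambda>(x, y). asm_eq ?E x y)
        (\<lambda>(x, y). rel_compose app p ?B ?G ?S x y)"
      \<comment> \<open>For \<open>c = pr x (f x)\<close> the graph contributes
        \<open>pr c x\<close>, with \<open>x = left c\<close>, and the inverse contributes
        \<open>c\<close>.\<close>
      by (rule unit[where F = "\<lambda>c. pr (pr c (left c)) c"], intro computable_intros)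
         (auto simp: defs split: if_splits)
  qed
  moreover have "rel_equiv app J ?B ?B (rel_compose app p ?B ?S ?G) (asm_eq ?F)"
    unfolding rel_equiv_def
  proof (intro conjI)
    show "entails app J (?B \<times> ?B) (\<lambda>(x, y). rel_compose app p ?B ?S ?G x y)
        (\<lambda>(x, y). asm_eq ?F x y)"
      by (rule unit[where F = "\<lambda>c. left (left c)"], intro computable_intros)
         (fastforce simp: defs split: if_splits)+
    show "entails app J (?B \<times> ?B) (\<lambda>(x, y). asm_eq ?F x y)
        (\<lambda>(x, y). rel_compose app p ?B ?S ?G x y)"
      by (rule entails_map[OF pca J graph, where F = "\<lambda>c. pr c (pr c (left c))"],
          intro computable_intros)
         (auto simp: defs split: if_splits)
  qed
  ultimately show ?thesis
    unfolding forces_realizable_def inverts_def by blast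
qed

lemma least_op_forcing_preimage:
  assumes J: "local_operator app J" and J_eq: "\<And>U. J U = {b. \<exists>a\<in>U. f b = Some a}"
  shows "least_op_forcing app p f J"
proof -
  have graph: "entails app J (dom f) (\<lambda>b. {b}) (graph_assembly app p f)"
  proof -
    \<comment> \<open>The map from \<open>f b\<close> to \<open>pr b (f b)\<close> depends on
      \<open>b\<close> too, so \<open>entails_map\<close> does not fit. Instead \<open>m\<close> is
      applied to the realizer \<open>p b\<close>, and the result to \<open>b\<close> again, now as
      an element of \<open>J {f b}\<close>.\<close>
    obtain m where m: "\<And>U V n. n \<in> imp app U V \<Longrightarrow> \<exists>q\<in>imp app (J U) (J V). app m n = Some q"
      using local_operator_mono[OF J] by blast
    define pb where "pb b = the (app p b)" for b
    define q where "q b = the (app m (pb b))" for b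
    have ex: "app m (pb b) = Some (q b) \<and>
        app (q b) b = Some (the (app (q b) b)) \<and>
        the (app (q b) b) \<in> J (graph_assembly app p f b)" if "b \<in> dom f" for b
    proof -
      from that obtain a where a: "f b = Some a" by blast
      have "pb b \<in> imp app {a} (graph_assembly app p f b)"
        using a unfolding imp_def pb_def graph_assembly_eq by (simp add: app_p_app)
      then obtain q' where "app m (pb b) = Some q'"
        and "q' \<in> imp app (J {a}) (J (graph_assembly app p f b))"
        using m by blast
      moreover have "b \<in> J {a}" using a J_eq by blast
      ultimately show ?thesis unfolding imp_def q_def by force
    qed
    have "computable app (\<Union>b\<in>dom f. {b}) pb"
      by (rule computableI[where r = p]) (unfold pb_def, rule app_p)
    then have "computable app (\<Union>b\<in>dom f. {b}) q"
      by (rule computable_app_const[OF pca, where r = m]) (use ex in blast)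
    then have "computable app (\<Union>b\<in>dom f. {b}) (\<lambda>b. the (app (q b) b))"
      by (rule computable_app[OF pca _ computable_id[OF pca]]) (use ex in blast)
    then show ?thesis
      by (rule entails_by_computable) (use ex in blast)
  qed
  \<comment> \<open>An element \<open>x\<close> of \<open>J U\<close> serves as its own index:
    \<open>f x\<close> is defined and lies in \<open>U\<close>, so the identity maps
    \<open>{the (f x)}\<close> into \<open>U\<close>.\<close>
  have "op_le app J L" if L: "local_operator app L" "forces_realizable app p L f" for L
    unfolding op_le_iff_entails
    by (rule entails_map[OF pca L(1) entails_value_of_forces_realizable[OF L],
          where F = "\<lambda>x. x"], intro computable_intros)
       (force simp: J_eq)
  then show ?thesis
    using J forces_realizable_if_entails_graph[OF J graph]
    unfolding least_op_forcing_def by blast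
qed

end

section \<open>From the operator to the partial function\<close>

lemma discrete_preserves_unions_preimage:
  assumes "discrete_op J" "preserves_unions J"
  obtains f where "\<And>U. J U = {b. \<exists>a\<in>U. f b = Some a}"
proof -
  define f where "f b = (if \<exists>a. b \<in> J {a} then Some (THE a. b \<in> J {a}) else None)" for b
  have f: "f b = Some a \<longleftrightarrow> b \<in> J {a}" for a b
  proof -
    \<comment> \<open>Discreteness says that the sets \<open>J {a}\<close> are pairwise disjoint, so
      at most one of them contains \<open>b\<close>.\<close>
    have "(THE a. b \<in> J {a}) = a" if "b \<in> J {a}" for a
      using that assms(1) unfolding discrete_op_def by blast
    then show ?thesis unfolding f_def by (auto split: if_splits)
  qed
  have "J U = (\<Union>a\<in>U. J {a})" for U
    using assms(2)[unfolded preserves_unions_def, rule_format, of "(\<lambda>a. {a}) ` U"] by simp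
  then have "J U = {b. \<exists>a\<in>U. f b = Some a}" for U
    unfolding f by blast
  then show thesis using that by blast
qed

theorem proposition3p8:
  fixes app :: "'a papp" and p p0 p1 :: 'a and J :: "'a set \<Rightarrow> 'a set"
  assumes "pca app"
    and "pairing app p p0 p1"
    and "local_operator app J"
    and "discrete_op J"
    and "preserves_unions J"
  shows "\<exists>(f :: 'a \<rightharpoonup> 'a) Jf. least_op_forcing app p f Jf \<and> op_iso app J Jf"
proof -
  interpret pca_pairing app p p0 p1
    using assms(1,2) by unfold_locales
  obtain f where "\<And>U. J U = {b. \<exists>a\<in>U. f b = Some a}"
    using discrete_preserves_unions_preimage[OF assms(4,5)] by blast
  then have "least_op_forcing app p f J"
    by (rule least_op_forcing_preimage[OF assms(3)])
  then show ?thesis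
    using op_iso_refl[OF assms(1)] by blast
qed

end
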